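(* Let $\mathcal{E}$ be a finite-dimensional real inner product space, $\mathcal{L}\subseteq\mathcal{E}$ a subspace and $a\in\mathcal{E}$. Let $\mathcal{K}\subseteq\mathcal{E}$ be a pointed closed convex amenable cone and let $$\mathcal{F}_\ell\subsetneq\cdots\subsetneq\mathcal{F}_1=\mathcal{K}$$ be a chain of faces of $\mathcal{K}$ together with $z_i\in\mathcal{F}_i^*\cap\mathcal{L}^\perp\cap\{a\}^\perp$ such that $(\mathcal{F}_\ell,\mathcal{L},a)$ satisfies the PPS condition and $\mathcal{F}_{i+1}=\mathcal{F}_i\cap\{z_i\}^\perp$ for $i=1,\dots,\ell-1$. For $i=1,\dots,\ell-1$, let $\psi_i$ be a facial residual function for $\mathcal{F}_i,z_i$ (with respect to $\mathcal{K}$). Then, after replacing each $\psi_i$ by a suitable positive rescaling of itself, there is a positive constant $\kappa$ (depending on $\mathcal{K},\mathcal{L},a,\mathcal{F}_\ell$) such that whenever $x\in\operatorname{span}\mathcal{K}$ and $\epsilon$ satisfy $$\operatorname{dist}(x,\mathcal{K})\le\epsilon,\qquad\operatorname{dist}(x,\mathcal{L}+a)\le\epsilon,$$ we have $$\operatorname{dist}\bigl(x,(\mathcal{L}+a)\cap\mathcal{K}\bigr)\le(\kappa\|x\|+\kappa)\bigl(\epsilon+\varphi(\epsilon,\|x\|)\bigr),$$ where $\varphi=\psi_{\ell-1}\diamondsuit\cdots\diamondsuit\psi_1$ if $\ell\ge2$, and $\varphi(\epsilon,\|x\|)=\epsilon$ if $\ell=1$.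
   Context: $\|x\|=\sqrt{\langle x,x\rangle}$ and $\operatorname{dist}(x,C)=\inf\{\|x-y\|: y\in C\}$. A convex cone is a nonempty set closed under nonnegative linear combinations; it is pointed if $\mathcal{K}\cap-\mathcal{K}=\{0\}$. A face of $\mathcal{K}$ is a convex cone $\mathcal{F}\subseteq\mathcal{K}$ such that $x,y\in\mathcal{K}$, $x+y\in\mathcal{F}$ imply $x,y\in\mathcal{F}$. $C^*=\{x:\langle x,y\rangle\ge0\ \forall y\in C\}$, $C^\perp$ is the orthogonal complement, $\operatorname{ri}$ the relative interior. $\mathcal{K}$ is amenable if for every face $\mathcal{F}$ of $\mathcal{K}$ there is $\kappa>0$ such that $\operatorname{dist}(x,\mathcal{F})\le\kappa\operatorname{dist}(x,\mathcal{K})$ for all $x\in\operatorname{span}\mathcal{F}$. PPS (partial polyhedral Slater) condition: for a closed convex cone $\mathcal{C}\subseteq\mathcal{E}$, $(\mathcal{C},\mathcal{L},a)$ satisfies the PPS condition if $\mathcal{E}$ can be written as an orthogonal product $\mathcal{E}=\mathcal{E}^1\times\mathcal{E}^2$ (a factor may be $\{0\}$) with $\mathcal{C}=\mathcal{C}^1\times\mathcal{C}^2$, where $\mathcal{C}^i\subseteq\mathcal{E}^i$ are closed convex cones, $\mathcal{C}^2$ is polyhedral, and there is $(x_1,x_2)\in\mathcal{L}+a$ with $x_1\in\operatorname{ri}\mathcal{C}^1$, $x_2\in\mathcal{C}^2$. (So it holds if $(\operatorname{ri}\mathcal{C})\cap(\mathcal{L}+a)\ne\emptyset$, or if $\mathcal{C}$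 is polyhedral and $\mathcal{C}\cap(\mathcal{L}+a)\neq\emptyset$.) Facial residual function: let $\mathcal{F}$ be a face of $\mathcal{K}$ and $z\in\mathcal{F}^*$. A function $\psi:\mathbb{R}_+\times\mathbb{R}_+\to\mathbb{R}_+$ is a facial residual function for $\mathcal{F},z$ (with respect to $\mathcal{K}$) if (1) it is nonnegative, monotone nondecreasing in each argument, and $\psi(0,\alpha)=0$ for all $\alpha\ge0$; (2) whenever $x\in\operatorname{span}\mathcal{K}$ and $\epsilon\ge0$ satisfy $\operatorname{dist}(x,\mathcal{K})\le\epsilon$, $\langle x,z\rangle\le\epsilon$, $\operatorname{dist}(x,\operatorname{span}\mathcal{F})\le\epsilon$, we have $\operatorname{dist}(x,\mathcal{F}\cap\{z\}^\perp)\le\psi(\epsilon,\|x\|)$. A positive rescaling of $\psi$ is a function $(\epsilon,t)\mapsto M_3\,\psi(M_1\epsilon,M_2t)$ with constants $M_1,M_2,M_3>0$. The operation $\diamondsuit$ is $(f\diamondsuit g)(s,t)=f(s+g(s,t),t)$; iterated expressions are nested to the right: $\psi_{k}\diamondsuit\cdots\diamondsuit\psi_1=\psi_k\diamondsuit(\psi_{k-1}\diamondsuit\cdots\diamondsuit\psi_1)$. *)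

theory Defs
  imports "HOL-Analysis.Analysis"
begin

text \<open>
  The distance to a set is the library's \<^const>\<open>infdist\<close>. Its value \<open>0\<close> on the empty set is a
  convention of the library, but every set to which it is applied below is nonempty.
\<close>

definition pointed :: "'a::real_vector set \<Rightarrow> bool"
  where "pointed K \<longleftrightarrow> K \<inter> uminus ` K = {0}"

definition dual_cone :: "'a::real_inner set \<Rightarrow> 'a set"
  where "dual_cone C = {x. \<forall>y\<in>C. 0 \<le> x \<bullet> y}"

definition cone_face :: "'a::real_vector set \<Rightarrow> 'a set \<Rightarrow> bool"
  where "cone_face F K \<longleftrightarrow>
    convex_cone F \<and> F \<subseteq> K \<and> (\<forall>x\<in>K. \<forall>y\<in>K. x + y \<in> F \<longrightarrow> x \<in> F \<and> y \<in> F)"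

text \<open>On convex cones these are exactly the nonempty faces in the sense of \<^const>\<open>face_of\<close>.\<close>

lemma cone_face_iff_face_of:
  assumes K: "convex_cone K"
  shows "cone_face F K \<longleftrightarrow> F \<noteq> {} \<and> F face_of K"
proof
  assume F: "cone_face F K"
  then have cF: "convex_cone F" and sub: "F \<subseteq> K"
    and fc: "\<And>x y. x \<in> K \<Longrightarrow> y \<in> K \<Longrightarrow> x + y \<in> F \<Longrightarrow> x \<in> F \<and> y \<in> F"
    by (auto simp: cone_face_def)
  have scale: "x \<in> F" if "c *\<^sub>R x \<in> F" "c > 0" for c :: real and x
  proof -
    have "inverse c *\<^sub>R (c *\<^sub>R x) \<in> F"
      using cF that conicD[of F "c *\<^sub>R x" "inverse c"] by (simp add: convex_cone_def)
    then show ?thesis using that by simp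
  qed
  have seg: "p \<in> F \<and> q \<in> F" if pq: "p \<in> K" "q \<in> K" "x \<in> F" "x \<in> open_segment p q" for p q x
  proof -
    obtain u where u: "0 < u" "u < 1" "x = (1 - u) *\<^sub>R p + u *\<^sub>R q"
      using pq(4) by (auto simp: in_segment)
    have "(1 - u) *\<^sub>R p \<in> K" "u *\<^sub>R q \<in> K"
      using K pq u unfolding convex_cone_iff by auto
    then have "(1 - u) *\<^sub>R p \<in> F \<and> u *\<^sub>R q \<in> F"
      using fc[of "(1 - u) *\<^sub>R p" "u *\<^sub>R q"] pq(3) u(3) by simp
    then show ?thesis using scale[of "1 - u" p] scale[of u q] u(1,2) by simp
  qed
  have "F \<noteq> {}" "convex F" using cF by (auto simp: convex_cone_def)
  then show "F \<noteq> {} \<and> F face_of K"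
    unfolding face_of_def using sub seg by (intro conjI ballI impI; blast)
next
  assume F: "F \<noteq> {} \<and> F face_of K"
  then have sub: "F \<subseteq> K" and conv: "convex F" and ne: "F \<noteq> {}"
    and fc: "\<And>p q x. p \<in> K \<Longrightarrow> q \<in> K \<Longrightarrow> x \<in> F \<Longrightarrow> x \<in> open_segment p q \<Longrightarrow> p \<in> F \<and> q \<in> F"
    unfolding face_of_def by blast+
  have K0: "0 \<in> K" and Ks: "\<And>x c. x \<in> K \<Longrightarrow> 0 \<le> c \<Longrightarrow> c *\<^sub>R x \<in> K"
    using K unfolding convex_cone_iff by auto
  have ray: "0 \<in> F \<and> c *\<^sub>R x \<in> F" if x: "x \<in> F" "1 < c" for x and c :: real
  proof (cases "x = 0")
    case True
    then show ?thesis using x by simp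
  next
    case False
    have "x = (1 - inverse c) *\<^sub>R 0 + inverse c *\<^sub>R (c *\<^sub>R x)" using x by simp
    moreover have "0 < inverse c" "inverse c < 1" using x by (auto simp: field_simps)
    moreover have "0 \<noteq> c *\<^sub>R x" using False x by simp
    ultimately have "x \<in> open_segment 0 (c *\<^sub>R x)" unfolding in_segment by blast
    moreover have "c *\<^sub>R x \<in> K" using Ks[of x c] x sub by auto
    ultimately show ?thesis using fc[OF K0 _ x(1)] by blast
  qed
  have F0: "0 \<in> F" using ne ray[of _ 2] by auto
  have con: "c *\<^sub>R x \<in> F" if "x \<in> F" "0 \<le> c" for x and c :: real
  proof (cases "c \<le> 1")
    case True
    have "(1 - c) *\<^sub>R 0 + c *\<^sub>R x \<in> F"
      using conv F0 that True unfolding convex_alt by blast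
    then show ?thesis by simp
  next
    case False
    then show ?thesis using ray that by auto
  qed
  have cF: "convex_cone F" using ne conv con unfolding convex_cone_def conic_def by blast
  have "x \<in> F \<and> y \<in> F" if xy: "x \<in> K" "y \<in> K" "x + y \<in> F" for x y
  proof (cases "x = y")
    case True
    then have "(1/2) *\<^sub>R (x + y) = x" using scaleR_half_double[of x] by simp
    then show ?thesis using con[OF xy(3), of "1/2"] True by simp
  next
    case False
    have "(1/2) *\<^sub>R (x + y) = (1 - 1/2) *\<^sub>R x + (1/2) *\<^sub>R y" by (simp add: algebra_simps)
    then have "(1/2) *\<^sub>R (x + y) \<in> open_segment x y"
      using False unfolding in_segment by (intro conjI exI[of _ "1/2"]) auto
    then show ?thesis using fc[OF xy(1,2) con[OF xy(3), of "1/2"]] by simp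
  qed
  then show "cone_face F K" using cF sub unfolding cone_face_def by blast
qed

definition amenable :: "'a::real_inner set \<Rightarrow> bool"
  where "amenable K \<longleftrightarrow>
    (\<forall>F. cone_face F K \<longrightarrow> (\<exists>\<kappa>>0. \<forall>x\<in>span F. infdist x F \<le> \<kappa> * infdist x K))"

text \<open>
  The orthogonal product \<open>E1 \<times> E2\<close> is an internal one: \<open>E1\<close> and \<open>E2\<close> are mutually orthogonal
  subspaces that together span the whole space, and the pair \<open>(x1, x2)\<close> is the vector \<open>x1 + x2\<close>.
\<close>

definition pps_condition :: "'a::euclidean_space set \<Rightarrow> 'a set \<Rightarrow> 'a \<Rightarrow> bool"
  where "pps_condition C L a \<longleftrightarrow>
    (\<exists>E1 E2 C1 C2.
       subspace E1 \<and> subspace E2 \<and> (\<forall>x\<in>E1. \<forall>y\<in>E2. orthogonal x y) \<and>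
       {x1 + x2 | x1 x2. x1 \<in> E1 \<and> x2 \<in> E2} = UNIV \<and>
       C1 \<subseteq> E1 \<and> closed C1 \<and> convex_cone C1 \<and>
       C2 \<subseteq> E2 \<and> closed C2 \<and> convex_cone C2 \<and> polyhedron C2 \<and>
       C = {x1 + x2 | x1 x2. x1 \<in> C1 \<and> x2 \<in> C2} \<and>
       (\<exists>x1 x2. x1 + x2 \<in> (\<lambda>x. x + a) ` L \<and> x1 \<in> rel_interior C1 \<and> x2 \<in> C2))"

text \<open>
  Functions from \<open>\<real>\<^sub>+ \<times> \<real>\<^sub>+\<close> to \<open>\<real>\<^sub>+\<close> are rendered as curried total functions on the reals that are
  constrained only at nonnegative arguments; values elsewhere are irrelevant.
\<close>

definition facial_residual_function ::
    "'a::real_inner set \<Rightarrow> 'a set \<Rightarrow> 'a \<Rightarrow> (real \<Rightarrow> real \<Rightarrow> real) \<Rightarrow> bool"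
  where "facial_residual_function K F z \<psi> \<longleftrightarrow>
    (\<forall>s\<ge>0. \<forall>t\<ge>0. 0 \<le> \<psi> s t) \<and>
    (\<forall>t\<ge>0. mono_on {0..} (\<lambda>s. \<psi> s t)) \<and>
    (\<forall>s\<ge>0. mono_on {0..} (\<lambda>t. \<psi> s t)) \<and>
    (\<forall>t\<ge>0. \<psi> 0 t = 0) \<and>
    (\<forall>x\<in>span K. \<forall>\<epsilon>\<ge>0.
       infdist x K \<le> \<epsilon> \<and> x \<bullet> z \<le> \<epsilon> \<and> infdist x (span F) \<le> \<epsilon> \<longrightarrow>
       infdist x (F \<inter> {z}\<^sup>\<bottom>) \<le> \<psi> \<epsilon> (norm x))"

definition positive_rescaling :: "(real \<Rightarrow> real \<Rightarrow> real) \<Rightarrow> (real \<Rightarrow> real \<Rightarrow> real) \<Rightarrow> bool"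
  where "positive_rescaling \<psi> \<psi>' \<longleftrightarrow>
    (\<exists>M1>0. \<exists>M2>0. \<exists>M3>0. \<psi>' = (\<lambda>s t. M3 * \<psi> (M1 * s) (M2 * t)))"

definition diamond ::
    "(real \<Rightarrow> real \<Rightarrow> real) \<Rightarrow> (real \<Rightarrow> real \<Rightarrow> real) \<Rightarrow> real \<Rightarrow> real \<Rightarrow> real"  (infixr "\<diamondop>" 65)
  where "f \<diamondop> g = (\<lambda>s t. f (s + g s t) t)"

text \<open>\<open>diamonds \<psi> k = \<psi> k \<diamondop> (\<psi> (k - 1) \<diamondop> \<dots> \<diamondop> \<psi> 1)\<close>, for \<open>k \<ge> 1\<close> only.\<close>

fun diamonds :: "(nat \<Rightarrow> real \<Rightarrow> real \<Rightarrow> real) \<Rightarrow> nat \<Rightarrow> real \<Rightarrow> real \<Rightarrow> real"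
  where
    "diamonds \<psi> (Suc 0) = \<psi> 1"
  | "diamonds \<psi> (Suc (Suc k)) = \<psi> (Suc (Suc k)) \<diamondop> diamonds \<psi> (Suc k)"

definition chain_residual :: "(nat \<Rightarrow> real \<Rightarrow> real \<Rightarrow> real) \<Rightarrow> nat \<Rightarrow> real \<Rightarrow> real \<Rightarrow> real"
  where "chain_residual \<psi> l = (if l \<ge> 2 then diamonds \<psi> (l - 1) else (\<lambda>s t. s))"

definition facial_reduction_chain ::
    "'a::real_inner set \<Rightarrow> 'a set \<Rightarrow> 'a \<Rightarrow> nat \<Rightarrow> (nat \<Rightarrow> 'a set) \<Rightarrow> (nat \<Rightarrow> 'a) \<Rightarrow> bool"
  where "facial_reduction_chain K L a l F z \<longleftrightarrow>
    l \<ge> 1 \<and> F 1 = K \<and>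
    (\<forall>i\<in>{1..l}. cone_face (F i) K) \<and>
    (\<forall>i\<in>{1..<l}. F (i + 1) \<subset> F i \<and>
       z i \<in> dual_cone (F i) \<inter> L\<^sup>\<bottom> \<inter> {a}\<^sup>\<bottom> \<and>
       F (i + 1) = F i \<inter> {z i}\<^sup>\<bottom>)"

end

theory Submission
  imports Defs
begin

text \<open>
  Vectors orthogonal to both \<open>L\<close> and \<open>a\<close> pair with \<open>x\<close> to at most a multiple of the distance of \<open>x\<close>
  to \<open>L + a\<close>. So one application of \<open>\<psi> i\<close> per step of the chain, with its first argument rescaled by
  \<open>max 1 (norm (z i))\<close>, bounds the distance of \<open>x\<close> to \<open>F l\<close> by the chain residual. What remains is an
  error bound for \<open>F l\<close> and \<open>L + a\<close> under the PPS condition. There a Hoffman bound first moves \<open>x\<close> to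
  a point of \<open>L + a\<close> lying in the span of the first factor and in the polyhedral second factor, and a
  convex combination with the Slater point then moves it into the cone.
\<close>

section \<open>Hoffman's error bound\<close>

text \<open>A compactness argument on the unit sphere replaces Farkas' lemma and Caratheodory's theorem:
  a nonzero \<open>v\<close> in the polar cone cannot satisfy all inequalities \<open>a i \<bullet> v \<le> 0\<close>, since otherwise
  \<open>v \<bullet> v \<le> 0\<close>.\<close>

lemma polar_norm_bound:
  fixes a :: "'i \<Rightarrow> 'a::euclidean_space"
  assumes "finite J"
  shows "\<exists>c>0. \<forall>v. (\<forall>d. (\<forall>i\<in>J. a i \<bullet> d \<le> 0) \<longrightarrow> v \<bullet> d \<le> 0) \<longrightarrow>
    norm v \<le> c * (\<Sum>i\<in>J. max 0 (a i \<bullet> v))"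
proof -
  define N where "N = {v. \<forall>d. (\<forall>i\<in>J. a i \<bullet> d \<le> 0) \<longrightarrow> v \<bullet> d \<le> 0}"
  define f where "f v = (\<Sum>i\<in>J. max 0 (a i \<bullet> v))" for v
  have scale: "c *\<^sub>R v \<in> N" if "v \<in> N" "c \<ge> 0" for c v
    using that by (auto simp: N_def mult_nonneg_nonpos)
  have "N = (\<Inter>d\<in>{d. \<forall>i\<in>J. a i \<bullet> d \<le> 0}. {v. d \<bullet> v \<le> 0})"
    by (auto simp: N_def inner_commute)
  then have "closed N"
    by (auto intro: closed_halfspace_le)
  then have comp: "compact (N \<inter> sphere 0 1)"
    by (simp add: closed_Int_compact)
  have pos: "f v > 0" if v: "v \<in> N" "v \<noteq> 0" for v
  proof -
    have "\<not> (\<forall>i\<in>J. a i \<bullet> v \<le> 0)"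
    proof
      assume "\<forall>i\<in>J. a i \<bullet> v \<le> 0"
      then have "v \<bullet> v \<le> 0" using v(1) unfolding N_def by blast
      then show False using v(2) inner_gt_zero_iff[of v] by linarith
    qed
    then obtain i where "i \<in> J" "a i \<bullet> v > 0"
      by (auto simp: not_le)
    then show ?thesis
      unfolding f_def by (intro sum_pos2[OF assms]) auto
  qed
  \<comment> \<open>If \<open>N\<close> misses the sphere, any \<open>m\<close> will do; otherwise
    compactness supplies a positive minimum. As \<open>f\<close> is positively homogeneous,
    \<open>inverse m\<close> then serves on all of \<open>N\<close>.\<close>
  obtain m where m: "m > 0" "\<And>v. v \<in> N \<inter> sphere 0 1 \<Longrightarrow> m \<le> f v"
  proof (cases "N \<inter> sphere 0 1 = {}")
    case True
    then show ?thesis using that[of 1] by auto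
  next
    case False
    have "continuous_on (N \<inter> sphere 0 1) f"
      unfolding f_def
      by (intro continuous_on_sum continuous_on_max continuous_on_inner continuous_on_const continuous_on_id)
    then obtain u where u: "u \<in> N \<inter> sphere 0 1" "\<And>v. v \<in> N \<inter> sphere 0 1 \<Longrightarrow> f u \<le> f v"
      using continuous_attains_inf[OF comp False] by blast
    have "u \<in> N" "u \<noteq> 0" using u(1) by auto
    then show ?thesis using that[of "f u"] pos u(2) by blast
  qed
  have "norm v \<le> inverse m * f v" if v: "v \<in> N" for v
  proof (cases "v = 0")
    case True
    then show ?thesis by (simp add: f_def)
  next
    case False
    then have "m \<le> f (inverse (norm v) *\<^sub>R v)"
      using scale[OF v] by (intro m) simp
    also have "\<dots> = inverse (norm v) * f v"
      unfolding f_def sum_distrib_left by (intro sum.cong) (auto simp: max_def zero_le_mult_iff)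
    finally show ?thesis using m False by (simp add: field_simps)
  qed
  then show ?thesis
    using m(1) unfolding N_def f_def by (intro exI[of _ "inverse m"]) auto
qed

text \<open>With \<open>y\<close> the point of the polyhedron nearest to \<open>x\<close>, the
  residual \<open>x - y\<close> is polar to every direction allowed by the inequalities tight at
  \<open>y\<close>, so \<open>polar_norm_bound\<close> controls its length by the excesses of those
  tight inequalities alone.\<close>

lemma hoffman_inequalities:
  fixes a :: "'i \<Rightarrow> 'a::euclidean_space" and b :: "'i \<Rightarrow> real"
  assumes fin: "finite I" and ne: "{x. \<forall>i\<in>I. a i \<bullet> x \<le> b i} \<noteq> {}"
  shows "\<exists>c>0. \<forall>x. infdist x {x. \<forall>i\<in>I. a i \<bullet> x \<le> b i} \<le> c * (\<Sum>i\<in>I. max 0 (a i \<bullet> x - b i))"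
proof -
  define P where "P = {x. \<forall>i\<in>I. a i \<bullet> x \<le> b i}"
  have "P = (\<Inter>i\<in>I. {x. a i \<bullet> x \<le> b i})"
    by (auto simp: P_def)
  then have P: "closed P" "convex P" "P \<noteq> {}"
    using ne by (auto simp: P_def[symmetric] intro: closed_halfspace_le convex_halfspace_le convex_INT)
  have "\<forall>J\<in>Pow I. \<exists>c>0. \<forall>v. (\<forall>d. (\<forall>i\<in>J. a i \<bullet> d \<le> 0) \<longrightarrow> v \<bullet> d \<le> 0) \<longrightarrow>
    norm v \<le> c * (\<Sum>i\<in>J. max 0 (a i \<bullet> v))"
    using fin by (auto intro!: polar_norm_bound intro: finite_subset)
  then obtain c where c: "\<And>J. J \<subseteq> I \<Longrightarrow> c J > 0"
    "\<And>J v. J \<subseteq> I \<Longrightarrow> (\<And>d. (\<And>i. i \<in> J \<Longrightarrow> a i \<bullet> d \<le> 0) \<Longrightarrow> v \<bullet> d \<le> 0) \<Longrightarrow>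
    norm v \<le> c J * (\<Sum>i\<in>J. max 0 (a i \<bullet> v))"
    unfolding Bex_def bchoice_iff by (metis PowI)
  \<comment> \<open>The tight set varies with \<open>x\<close>; summing over all subsets of
    \<open>I\<close> makes the constant uniform.\<close>
  define C where "C = (\<Sum>J\<in>Pow I. c J)"
  have cC: "c J \<le> C" if "J \<subseteq> I" for J
    unfolding C_def using c(1) that fin by (intro member_le_sum) (auto simp: less_imp_le)
  have "infdist x P \<le> C * (\<Sum>i\<in>I. max 0 (a i \<bullet> x - b i))" for x
  proof -
    define y where "y = closest_point P x"
    define J where "J = {i\<in>I. a i \<bullet> y = b i}"
    have yP: "y \<in> P"
      unfolding y_def by (intro closest_point_in_set P)
    have JI: "J \<subseteq> I" by (auto simp: J_def)
    have "(x - y) \<bullet> d \<le> 0" if d: "\<And>i. i \<in> J \<Longrightarrow> a i \<bullet> d \<le> 0" for d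
    proof -
      \<comment> \<open>For small positive \<open>t\<close> a tight inequality survives because
        \<open>a i \<bullet> d \<le> 0\<close>, a slack one by continuity; finiteness of
        \<open>I\<close> gives one \<open>t\<close> for all.\<close>
      have "\<forall>i\<in>I. \<forall>\<^sub>F t in at_right 0. a i \<bullet> (y + t *\<^sub>R d) \<le> b i"
      proof
        fix i assume i: "i \<in> I"
        show "\<forall>\<^sub>F t in at_right 0. a i \<bullet> (y + t *\<^sub>R d) \<le> b i"
        proof (cases "i \<in> J")
          case True
          then show ?thesis
            using d[OF True] eventually_at_right_less[of "0::real"]
            by (auto elim!: eventually_mono simp: J_def inner_add_right mult_nonneg_nonpos)
        next
          case False
          then have "a i \<bullet> (y + 0 *\<^sub>R d) < b i"
            using yP i by (force simp: J_def P_def)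
          moreover have "((\<lambda>t. a i \<bullet> (y + t *\<^sub>R d)) \<longlongrightarrow> a i \<bullet> (y + 0 *\<^sub>R d)) (at_right 0)"
            by (intro tendsto_intros)
          ultimately show ?thesis
            using order_tendstoD(2) by (fastforce elim!: eventually_mono)
        qed
      qed
      then have "\<forall>\<^sub>F t in at_right 0. y + t *\<^sub>R d \<in> P"
        using fin unfolding P_def by (simp add: eventually_ball_finite)
      then have "\<forall>\<^sub>F t in at_right (0::real). y + t *\<^sub>R d \<in> P \<and> 0 < t"
        by (intro eventually_conj eventually_at_right_less)
      then obtain t :: real where t: "y + t *\<^sub>R d \<in> P" "0 < t"
        using eventually_happens by force
      have "(x - y) \<bullet> (y + t *\<^sub>R d - y) \<le> 0"
        unfolding y_def by (intro closest_point_dot P t(1)[unfolded y_def])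
      then show ?thesis using t(2) by (simp add: mult_le_0_iff)
    qed
    then have "norm (x - y) \<le> c J * (\<Sum>i\<in>J. max 0 (a i \<bullet> (x - y)))"
      by (intro c(2) JI) auto
    also have "\<dots> = c J * (\<Sum>i\<in>J. max 0 (a i \<bullet> x - b i))"
      by (auto simp: J_def inner_diff_right)
    also have "\<dots> \<le> C * (\<Sum>i\<in>I. max 0 (a i \<bullet> x - b i))"
      using cC[OF JI] c(1)[OF JI] JI fin
      by (intro mult_mono sum_mono2) (auto intro: sum_nonneg)
    finally show ?thesis
      using infdist_le[OF yP, of x] by (simp add: dist_norm)
  qed
  moreover have "C > 0"
    using cC[of "{}"] c(1)[of "{}"] by simp
  ultimately show ?thesis unfolding P_def by blast
qed

lemma polyhedron_inequalities:
  assumes "polyhedron A"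
  obtains I where "finite I" "A = {x. \<forall>p\<in>I. fst p \<bullet> x \<le> snd p}"
proof -
  obtain F where F: "finite F" "A = \<Inter>F" "\<forall>h\<in>F. \<exists>a b. a \<noteq> 0 \<and> h = {x. a \<bullet> x \<le> b}"
    using assms unfolding polyhedron_def by blast
  then have "\<forall>h\<in>F. \<exists>p. h = {x. fst p \<bullet> x \<le> snd p}"
    by (metis fst_conv snd_conv)
  then obtain p where p: "\<And>h. h \<in> F \<Longrightarrow> h = {x. fst (p h) \<bullet> x \<le> snd (p h)}"
    by metis
  then have "A = {x. \<forall>p\<in>p ` F. fst p \<bullet> x \<le> snd p}"
    unfolding F(2) by blast
  then show ?thesis using that F(1) by blast
qed

text \<open>An inequality valid on \<open>A\<close> or on \<open>B\<close> is violated at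
  \<open>x\<close> by at most the norm of its normal times the distance to that set, so the
  violations in \<open>hoffman_inequalities\<close> turn into distances.\<close>

lemma hoffman_polyhedra:
  fixes A B :: "'a::euclidean_space set"
  assumes "polyhedron A" "polyhedron B" "A \<inter> B \<noteq> {}"
  shows "\<exists>c>0. \<forall>x. infdist x (A \<inter> B) \<le> c * (infdist x A + infdist x B)"
proof -
  obtain I where I: "finite I" "A = {x. \<forall>p\<in>I. fst p \<bullet> x \<le> snd p}"
    using polyhedron_inequalities[OF assms(1)] .
  obtain J where J: "finite J" "B = {x. \<forall>p\<in>J. fst p \<bullet> x \<le> snd p}"
    using polyhedron_inequalities[OF assms(2)] .
  have AB: "A \<inter> B = {x. \<forall>p\<in>I \<union> J. fst p \<bullet> x \<le> snd p}"
    using I J by auto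
  obtain c where c: "c > 0"
    "\<And>x. infdist x (A \<inter> B) \<le> c * (\<Sum>p\<in>I \<union> J. max 0 (fst p \<bullet> x - snd p))"
    using hoffman_inequalities[of "I \<union> J" fst snd] I J assms(3) unfolding AB by auto
  \<comment> \<open>This sum can vanish, so the constant is built from \<open>S + 1\<close>, which
    stays positive.\<close>
  define S where "S = (\<Sum>p\<in>I \<union> J. norm (fst p))"
  have viol: "max 0 (fst p \<bullet> x - snd p) \<le> norm (fst p) * infdist x X"
    if X: "polyhedron X" "X \<noteq> {}" "X \<subseteq> {x. fst p \<bullet> x \<le> snd p}" for x :: 'a and p X
  proof -
    obtain y where y: "y \<in> X" "infdist x X = dist x y"
      using infdist_attains_inf[OF polyhedron_imp_closed[OF X(1)] X(2)] by blast
    then have "fst p \<bullet> x - snd p \<le> fst p \<bullet> (x - y)"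
      using X(3) by (auto simp: inner_diff_right)
    also have "\<dots> \<le> norm (fst p) * norm (x - y)"
      by (rule norm_cauchy_schwarz)
    finally show ?thesis using y by (simp add: dist_norm)
  qed
  have "infdist x (A \<inter> B) \<le> (c * (S + 1)) * (infdist x A + infdist x B)" for x
  proof -
    have "max 0 (fst p \<bullet> x - snd p) \<le> norm (fst p) * (infdist x A + infdist x B)"
      if "p \<in> I \<union> J" for p
    proof -
      have "A \<subseteq> {x. fst p \<bullet> x \<le> snd p} \<or> B \<subseteq> {x. fst p \<bullet> x \<le> snd p}"
        using that I J by auto
      then have "max 0 (fst p \<bullet> x - snd p) \<le> norm (fst p) * infdist x A \<or>
          max 0 (fst p \<bullet> x - snd p) \<le> norm (fst p) * infdist x B"
        using viol assms by blast
      moreover have "0 \<le> norm (fst p) * infdist x A" "0 \<le> norm (fst p) * infdist x B"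
        by (auto intro: mult_nonneg_nonneg infdist_nonneg)
      ultimately show ?thesis by (auto simp: distrib_left)
    qed
    then have "(\<Sum>p\<in>I \<union> J. max 0 (fst p \<bullet> x - snd p)) \<le> S * (infdist x A + infdist x B)"
      unfolding S_def sum_distrib_right by (intro sum_mono)
    also have "\<dots> \<le> (S + 1) * (infdist x A + infdist x B)"
      by (intro mult_right_mono add_nonneg_nonneg infdist_nonneg) auto
    finally have "c * (\<Sum>p\<in>I \<union> J. max 0 (fst p \<bullet> x - snd p)) \<le>
        c * ((S + 1) * (infdist x A + infdist x B))"
      using c(1) by (intro mult_left_mono) auto
    then show ?thesis
      using c(2)[of x] by (simp only: mult.assoc)
  qed
  moreover have "S \<ge> 0"
    by (simp add: S_def sum_nonneg)
  ultimately show ?thesis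
    using c(1) by (intro exI[of _ "c * (S + 1)"]) auto
qed

section \<open>The error bound under the PPS condition\<close>

text \<open>Replacing each normal of \<open>C\<close> by its \<open>E2\<close> component leaves its
  values on \<open>E2\<close> unchanged and makes it vanish on \<open>E1\<close>. So the sum is the
  subspace \<open>S + E2\<close> cut by finitely many half-spaces.\<close>

lemma polyhedron_orthogonal_sum:
  fixes C :: "'a::euclidean_space set"
  assumes E: "subspace E1" "subspace E2" "\<And>x y. x \<in> E1 \<Longrightarrow> y \<in> E2 \<Longrightarrow> x \<bullet> y = 0"
    "{x1 + x2 | x1 x2. x1 \<in> E1 \<and> x2 \<in> E2} = UNIV"
    and S: "subspace S" "S \<subseteq> E1" and C: "polyhedron C" "C \<subseteq> E2"
  shows "polyhedron {s + t | s t. s \<in> S \<and> t \<in> C}"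
proof -
  have "\<exists>u v. x = u + v \<and> u \<in> E1 \<and> v \<in> E2" for x
    using E(4) by blast
  then obtain u v where uv: "\<And>x. x = u x + v x" "\<And>x. u x \<in> E1" "\<And>x. v x \<in> E2"
    by metis
  obtain I where I: "finite I" "C = {x. \<forall>p\<in>I. fst p \<bullet> x \<le> snd p}"
    using polyhedron_inequalities[OF C(1)] by blast
  define V where "V = {s + t | s t. s \<in> S \<and> t \<in> E2}"
  have inner_v: "v q \<bullet> (s + t) = q \<bullet> t" if "s \<in> S" "t \<in> E2" for q s t
  proof -
    have "q \<bullet> t = (u q + v q) \<bullet> t" using uv(1) by metis
    moreover have "v q \<bullet> s = 0" using E(3)[of s "v q"] that S(2) uv(3) by (auto simp: inner_commute)
    moreover have "u q \<bullet> t = 0" using E(3) uv(2) that by blast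
    ultimately show ?thesis by (simp add: inner_add_left inner_add_right)
  qed
  have "{s + t | s t. s \<in> S \<and> t \<in> C} = V \<inter> (\<Inter>p\<in>I. {x. v (fst p) \<bullet> x \<le> snd p})"
  proof (intro equalityI subsetI)
    fix x assume "x \<in> {s + t | s t. s \<in> S \<and> t \<in> C}"
    then obtain s t where x: "x = s + t" "s \<in> S" "t \<in> C" by blast
    then have "t \<in> E2" using C(2) by blast
    then show "x \<in> V \<inter> (\<Inter>p\<in>I. {x. v (fst p) \<bullet> x \<le> snd p})"
      using x inner_v[OF x(2)] I(2) by (auto simp: V_def)
  next
    fix x assume x: "x \<in> V \<inter> (\<Inter>p\<in>I. {x. v (fst p) \<bullet> x \<le> snd p})"
    then obtain s t where st: "x = s + t" "s \<in> S" "t \<in> E2" unfolding V_def by blast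
    then have "t \<in> C" using x inner_v[OF st(2,3)] by (auto simp: I(2))
    then show "x \<in> {s + t | s t. s \<in> S \<and> t \<in> C}" using st by blast
  qed
  moreover have "polyhedron V"
    unfolding V_def by (intro affine_imp_polyhedron subspace_imp_affine subspace_sums S E)
  moreover have "polyhedron (\<Inter>p\<in>I. {x. v (fst p) \<bullet> x \<le> snd p})"
    using I(1) by (intro polyhedron_Inter) (auto intro: polyhedron_halfspace_le)
  ultimately show ?thesis by auto
qed

lemma affine_translate_subspace:
  fixes a :: "'a::real_vector"
  assumes "subspace L"
  shows "affine ((\<lambda>y. y + a) ` L)"
  using affine_translation[of L a] subspace_imp_affine[OF assms] by (simp add: add.commute[of a])

text \<open>The factor affine in \<open>norm x\<close> arises from the distance between the Slater
  point and a point near \<open>x\<close>. Nonemptiness is recorded too: \<open>infdist\<close> to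
  the empty set is zero, which would break the later passage to a larger cone.\<close>

lemma pps_error_bound:
  fixes C L :: "'a::euclidean_space set"
  assumes L: "subspace L" and pps: "pps_condition C L a"
  shows "(\<lambda>y. y + a) ` L \<inter> C \<noteq> {} \<and>
    (\<exists>\<kappa>>0. \<forall>x \<epsilon>. infdist x C \<le> \<epsilon> \<and> infdist x ((\<lambda>y. y + a) ` L) \<le> \<epsilon> \<longrightarrow>
      infdist x ((\<lambda>y. y + a) ` L \<inter> C) \<le> (\<kappa> * norm x + \<kappa>) * \<epsilon>)"
proof -
  define M where "M = (\<lambda>y. y + a) ` L"
  obtain E1 E2 C1 C2 x01 x02
    where UNIV: "{x1 + x2 | x1 x2. x1 \<in> E1 \<and> x2 \<in> E2} = UNIV"
    and C: "C = {x1 + x2 | x1 x2. x1 \<in> C1 \<and> x2 \<in> C2}"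
    and x0: "x01 + x02 \<in> M" "x01 \<in> rel_interior C1" "x02 \<in> C2"
    and sub: "subspace E1" "subspace E2" and orth: "\<forall>x\<in>E1. \<forall>y\<in>E2. orthogonal x y"
    and C1: "C1 \<subseteq> E1" "closed C1" "convex_cone C1"
    and C2: "C2 \<subseteq> E2" "convex_cone C2" "polyhedron C2"
    using pps unfolding pps_condition_def M_def[symmetric]
    by (elim exE conjE) (rule that)
  have E: "subspace E1" "subspace E2" "\<And>x y. x \<in> E1 \<Longrightarrow> y \<in> E2 \<Longrightarrow> x \<bullet> y = 0"
      "{x1 + x2 | x1 x2. x1 \<in> E1 \<and> x2 \<in> E2} = UNIV"
    using UNIV sub orth by (auto simp: orthogonal_def)
  define x0 where "x0 = x01 + x02"
  have C1': "0 \<in> C1" "\<And>x y. x \<in> C1 \<Longrightarrow> y \<in> C1 \<Longrightarrow> x + y \<in> C1"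
      "\<And>x c. x \<in> C1 \<Longrightarrow> 0 \<le> c \<Longrightarrow> c *\<^sub>R x \<in> C1"
    and C2': "0 \<in> C2" "\<And>x y. x \<in> C2 \<Longrightarrow> y \<in> C2 \<Longrightarrow> x + y \<in> C2"
      "\<And>x c. x \<in> C2 \<Longrightarrow> 0 \<le> c \<Longrightarrow> c *\<^sub>R x \<in> C2"
    using C1(3) C2(2) unfolding convex_cone_iff by auto
  have spE: "span C1 \<subseteq> E1"
    using C1(1) E(1) by (simp add: span_minimal)
  \<comment> \<open>Since \<open>0\<close> is in \<open>C1\<close>, its affine hull is its span, so
    relative interiority gives a ball within \<open>span C1\<close>.\<close>
  obtain \<delta> where d: "\<delta> > 0" "cball x01 \<delta> \<inter> span C1 \<subseteq> C1" and x01: "x01 \<in> C1"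
    using x0(2) C1'(1) unfolding mem_rel_interior_cball by (metis affine_hull_span_0 hull_inc)
  have affM: "affine M"
    unfolding M_def by (rule affine_translate_subspace[OF L])
  have aM: "a \<in> M" using L subspace_0 by (force simp: M_def)
  have C0: "0 \<in> C" unfolding C using C1'(1) C2'(1) by force
  have x0C: "x0 \<in> C" "x0 \<in> M" unfolding C x0_def using x01 x0 by auto
  \<comment> \<open>\<open>P\<close> relaxes \<open>C\<close> by replacing the first factor with its
    span. It is polyhedral, so the Hoffman bound applies to \<open>M\<close> and \<open>P\<close>,
    and only the first component remains to be corrected.\<close>
  define P where "P = {s + t | s t. s \<in> span C1 \<and> t \<in> C2}"
  have CP: "C \<subseteq> P" unfolding C P_def using span_superset by blast
  have polP: "polyhedron P"
    unfolding P_def by (intro polyhedron_orthogonal_sum[OF E] subspace_span spE C2)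
  have polM: "polyhedron M" using affM by (rule affine_imp_polyhedron)
  have "M \<inter> P \<noteq> {}" using x0C CP by blast
  then obtain c where c: "c > 0" "\<And>x. infdist x (M \<inter> P) \<le> c * (infdist x M + infdist x P)"
    using hoffman_polyhedra[OF polM polP] by blast
  \<comment> \<open>The sum of the constant term and the coefficient of \<open>norm x\<close> in the
    final estimate, so that it dominates both.\<close>
  define \<kappa> where "\<kappa> = c + (c + 1) / \<delta> * (norm x0 + c * norm a + 1 + 2 * c)"
  have k: "\<kappa> > 0"
    unfolding \<kappa>_def using c(1) d(1) by (intro add_pos_nonneg mult_nonneg_nonneg) auto
  have main: "infdist x (M \<inter> C) \<le> (\<kappa> * norm x + \<kappa>) * D" if D: "D = infdist x C + infdist x M" for x D
  proof -
    have D0: "D \<ge> 0" using D by (simp add: infdist_nonneg)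
    obtain y where y: "y \<in> M \<inter> P" "infdist x (M \<inter> P) = dist x y"
      using infdist_attains_inf[of "M \<inter> P"] \<open>M \<inter> P \<noteq> {}\<close> polM polP
      by (metis closed_Int polyhedron_imp_closed)
    have "infdist x P \<le> infdist x C" using CP C0 by (intro infdist_mono) auto
    then have "c * (infdist x M + infdist x P) \<le> c * D"
      using c(1) D by (intro mult_left_mono) auto
    then have xy: "dist x y \<le> c * D"
      using y(2) c(2)[of x] by linarith
    obtain y1 y2 where y12: "y = y1 + y2" "y1 \<in> span C1" "y2 \<in> C2"
      using y(1) by (auto simp: P_def)
    obtain q1 where q1: "q1 \<in> C1" "infdist y1 C1 = dist y1 q1"
      using infdist_attains_inf[OF C1(2)] C1'(1) by (metis empty_iff)
    \<comment> \<open>As \<open>y2\<close> already lies in \<open>C2\<close>, \<open>w\<close> is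
      the whole defect of \<open>y\<close>; by orthogonality no point of \<open>C\<close> is closer
      to \<open>y\<close> than \<open>norm w\<close>.\<close>
    define w where "w = y1 - q1"
    have wC: "w \<in> span C1" unfolding w_def using y12 q1 by (simp add: span_diff span_base)
    have "norm w \<le> dist y q" if q: "q \<in> C" for q
    proof -
      obtain p1 p2 where p: "q = p1 + p2" "p1 \<in> C1" "p2 \<in> C2"
        using q by (auto simp: C)
      have "y1 - p1 \<in> E1" "y2 - p2 \<in> E2"
        using C1(1) C2(1) y12 p E(1,2) spE by (auto intro: subspace_diff)
      then have "(y1 - p1) \<bullet> (y2 - p2) = 0" using E(3) by blast
      then have "norm (y1 - p1) \<le> norm ((y1 - p1) + (y2 - p2))"
        unfolding norm_le by (simp add: inner_add_left inner_add_right inner_commute)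
      then show ?thesis
        using infdist_le[OF p(2), of y1] q1(2) by (simp add: w_def y12 p dist_norm algebra_simps)
    qed
    then have "norm w \<le> infdist y C"
      unfolding infdist_def using C0 by (auto intro: cINF_greatest)
    also have "\<dots> \<le> infdist x C + dist y x"
      by (rule infdist_triangle)
    also have "\<dots> \<le> (c + 1) * D"
      using xy D infdist_nonneg[of x M] by (simp add: algebra_simps dist_commute)
    finally have w: "norm w \<le> (c + 1) * D" .
    \<comment> \<open>For nonzero \<open>w\<close> the weight makes
      \<open>(1 - lam) *\<^sub>R w\<close> equal to \<open>lam\<close> times a vector of length
      \<open>\<delta>\<close>, so the ball around \<open>x01\<close> can absorb the defect. For
      \<open>w = 0\<close> the weight is zero.\<close>
    define lam where "lam = norm w / (norm w + \<delta>)"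
    have nd: "norm w + \<delta> > 0" using d(1) by (simp add: add_nonneg_pos)
    have lam: "0 \<le> lam" "lam \<le> 1" "lam \<le> norm w / \<delta>"
      unfolding lam_def using d(1) nd by (auto simp: field_simps)
    have lam_w: "(1 - lam) *\<^sub>R w = lam *\<^sub>R ((\<delta> / norm w) *\<^sub>R w)"
    proof (cases "w = 0")
      case False
      have "1 - lam = lam * (\<delta> / norm w)"
        unfolding lam_def using False nd by (simp add: field_simps)
      then show ?thesis by simp
    qed simp
    define r where "r = x01 + (\<delta> / norm w) *\<^sub>R w"
    have rC: "r \<in> C1"
    proof -
      have "r \<in> span C1" unfolding r_def by (intro span_add span_mul span_base x01 wC)
      moreover have "r \<in> cball x01 \<delta>" unfolding r_def using d(1) by (simp add: dist_norm)
      ultimately show "r \<in> C1" using d(2) by blast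
    qed
    have 1: "lam *\<^sub>R r + (1 - lam) *\<^sub>R q1 \<in> C1"
      using lam q1(1) rC by (simp add: C1'(2,3))
    have 2: "lam *\<^sub>R x02 + (1 - lam) *\<^sub>R y2 \<in> C2"
      using lam y12(3) x0(3) by (simp add: C2'(2,3))
    \<comment> \<open>Combining with the Slater point stays in the affine set \<open>M\<close>, and
      the first component of \<open>u\<close> regroups as a convex combination of \<open>r\<close>
      and \<open>q1\<close>, both in \<open>C1\<close>.\<close>
    define u where "u = lam *\<^sub>R x0 + (1 - lam) *\<^sub>R y"
    have "y1 = w + q1" by (simp add: w_def)
    then have "u = (lam *\<^sub>R r + (1 - lam) *\<^sub>R q1) + (lam *\<^sub>R x02 + (1 - lam) *\<^sub>R y2)"
      unfolding u_def r_def x0_def y12(1) by (simp add: scaleR_add_right lam_w)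
    then have "u \<in> C" unfolding C using 1 2 by blast
    moreover have "u \<in> M"
      unfolding u_def using affM x0C(2) y(1) by (simp add: mem_affine)
    ultimately have "infdist x (M \<inter> C) \<le> dist x u"
      by (intro infdist_le) auto
    also have "\<dots> \<le> dist x y + dist y u" by (rule dist_triangle)
    also have "dist y u = norm (lam *\<^sub>R (y - x0))"
      by (simp add: dist_norm u_def algebra_simps)
    also have "\<dots> = lam * norm (y - x0)"
      using lam(1) by simp
    also have "\<dots> \<le> (norm w / \<delta>) * (norm y + norm x0)"
      using lam d(1) by (intro mult_mono norm_triangle_ineq4) auto
    also have "\<dots> \<le> ((c + 1) * D / \<delta>) * ((norm x + c * (2 * norm x + norm a)) + norm x0)"
    proof (intro mult_mono add_mono divide_right_mono w)
      \<comment> \<open>The points \<open>0\<close> of \<open>C\<close> and \<open>a\<close> of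
        \<open>M\<close> bound \<open>D\<close> by \<open>2 * norm x + norm a\<close>; this keeps
        the estimate linear in \<open>D\<close> with a coefficient affine in
        \<open>norm x\<close>.\<close>
      have "infdist x C \<le> norm x" using infdist_le[OF C0, of x] by simp
      moreover have "infdist x M \<le> norm x + norm a"
        using infdist_le[OF aM, of x] norm_triangle_ineq4[of x a] by (simp add: dist_norm)
      ultimately have "c * D \<le> c * (2 * norm x + norm a)"
        using D c(1) by simp
      moreover have "norm y \<le> norm x + dist x y"
        by (metis dist_norm norm_triangle_sub norm_minus_commute)
      ultimately show "norm y \<le> norm x + c * (2 * norm x + norm a)" using xy by simp
    qed (use d c D0 in auto)
    also have "dist x y + ((c + 1) * D / \<delta>) * ((norm x + c * (2 * norm x + norm a)) + norm x0)
      \<le> c * D + ((c + 1) * D / \<delta>) * ((norm x + c * (2 * norm x + norm a)) + norm x0)"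
      using xy by simp
    also have "\<dots> = (c + (c + 1) / \<delta> * (norm x0 + c * norm a) + (c + 1) / \<delta> * (1 + 2 * c) * norm x) * D"
      by (simp add: algebra_simps add_divide_distrib)
    also have "\<dots> \<le> (\<kappa> + \<kappa> * norm x) * D"
      unfolding \<kappa>_def using c(1) d(1) D0
      by (intro mult_right_mono add_mono) (auto simp: algebra_simps intro!: mult_nonneg_nonneg add_nonneg_nonneg divide_right_mono)
    finally show ?thesis by (simp add: add.commute)
  qed
  \<comment> \<open>The sum of the two distances is at most \<open>2 * \<epsilon>\<close>, hence the
    doubled constant.\<close>
  have "infdist x (M \<inter> C) \<le> ((2 * \<kappa>) * norm x + 2 * \<kappa>) * \<epsilon>"
    if "infdist x C \<le> \<epsilon>" "infdist x M \<le> \<epsilon>" for x \<epsilon>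
  proof -
    have "(\<kappa> * norm x + \<kappa>) * (infdist x C + infdist x M) \<le> (\<kappa> * norm x + \<kappa>) * (\<epsilon> + \<epsilon>)"
      using that k by (intro mult_left_mono add_mono) auto
    then show ?thesis using main[OF refl, of x] by (simp add: algebra_simps)
  qed
  then show ?thesis
    using k x0C unfolding M_def by (intro conjI exI[of _ "2 * \<kappa>"]) auto
qed

section \<open>Propagation along the chain\<close>

text \<open>\<open>z\<close> annihilates every point of \<open>L + a\<close>, so subtracting the
  nearest such point from \<open>x\<close> leaves \<open>x \<bullet> z\<close> unchanged, and
  Cauchy-Schwarz applies.\<close>

lemma inner_le_infdist:
  fixes z :: "'a::euclidean_space"
  assumes L: "subspace L" and z: "z \<in> L\<^sup>\<bottom> \<inter> {a}\<^sup>\<bottom>"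
  shows "x \<bullet> z \<le> norm z * infdist x ((\<lambda>y. y + a) ` L)"
proof -
  have "closed ((\<lambda>y. y + a) ` L)"
    by (intro polyhedron_imp_closed affine_imp_polyhedron affine_translate_subspace L)
  moreover have "(\<lambda>y. y + a) ` L \<noteq> {}"
    using subspace_0[OF L] by blast
  ultimately obtain y where y: "y \<in> L" "infdist x ((\<lambda>y. y + a) ` L) = dist x (y + a)"
    using infdist_attains_inf by (metis (no_types, lifting) imageE)
  then have "x \<bullet> z = (x - (y + a)) \<bullet> z"
    using z by (auto simp: orthogonal_comp_def orthogonal_def inner_diff_left inner_add_left)
  also have "\<dots> \<le> norm (x - (y + a)) * norm z"
    by (rule norm_cauchy_schwarz)
  finally show ?thesis using y by (simp add: dist_norm mult.commute)
qed

text \<open>The chain delivers distances to the face itself, and these dominate the distance to its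
  span that the residual function asks for. For empty \<open>F\<close> the value zero of
  \<open>infdist\<close> would spoil this comparison.\<close>

lemma facial_residual_step:
  assumes "facial_residual_function K F z \<psi>" "x \<in> span K"
    "infdist x K \<le> s" "x \<bullet> z \<le> s" "infdist x F \<le> s" "F \<noteq> {}"
  shows "infdist x (F \<inter> {z}\<^sup>\<bottom>) \<le> \<psi> s (norm x)"
proof -
  have "infdist x (span F) \<le> s"
    using infdist_mono[OF span_superset assms(6), of x] assms(5) by simp
  moreover have "s \<ge> 0" using assms(3) infdist_nonneg[of x K] by linarith
  ultimately show ?thesis
    using assms unfolding facial_residual_function_def by blast
qed

text \<open>The distance bound for each face is fed into the residual function of that face. Indices
  are shifted because \<open>diamonds\<close> starts at \<open>Suc 0\<close>.\<close>

lemma infdist_chain_le_diamonds: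
  fixes K L :: "'a::euclidean_space set"
  assumes L: "subspace L" and ch: "facial_reduction_chain K L a l F z"
    and frf: "\<And>i. i \<in> {1..<l} \<Longrightarrow> facial_residual_function K (F i) (z i) (\<psi> i)"
    and \<psi>': "\<And>i. \<psi>' i = (\<lambda>s. \<psi> i (max 1 (norm (z i)) * s))"
    and x: "x \<in> span K" "infdist x K \<le> \<epsilon>" "infdist x ((\<lambda>y. y + a) ` L) \<le> \<epsilon>"
    and n: "Suc n < l"
  shows "infdist x (F (Suc (Suc n))) \<le> diamonds \<psi>' (Suc n) \<epsilon> (norm x)"
  using n
proof (induction n)
  have e0: "\<epsilon> \<ge> 0" using x(2) infdist_nonneg[of x K] by linarith
  \<comment> \<open>A general \<open>s\<close> is needed, since \<open>\<diamondop>\<close> passes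
    on \<open>\<epsilon>\<close> plus the residual accumulated so far.\<close>
  have step: "infdist x (F (Suc i)) \<le> \<psi>' i s (norm x)"
    if i: "i \<in> {1..<l}" and s: "\<epsilon> \<le> s" "infdist x (F i) \<le> s" for i s
  proof -
    let ?m = "max 1 (norm (z i))"
    have zi: "z i \<in> L\<^sup>\<bottom> \<inter> {a}\<^sup>\<bottom>" and F: "F (Suc i) = F i \<inter> {z i}\<^sup>\<bottom>" "F i \<noteq> {}"
      using ch i unfolding facial_reduction_chain_def cone_face_def convex_cone_def by auto
    \<comment> \<open>The maximum with \<open>1\<close> lets \<open>?m * s\<close> bound the two
      distances as well as the inner product with \<open>z i\<close>.\<close>
    have "1 * s \<le> ?m * s" using s e0 by (intro mult_right_mono) auto
    then have ms: "s \<le> ?m * s" by simp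
    have "x \<bullet> z i \<le> norm (z i) * infdist x ((\<lambda>y. y + a) ` L)"
      by (rule inner_le_infdist[OF L zi])
    also have "\<dots> \<le> ?m * s"
      using x s e0 by (intro mult_mono) (auto simp: infdist_nonneg)
    finally show ?thesis
      unfolding F(1) \<psi>' using frf[OF i] x s ms F(2) by (intro facial_residual_step) auto
  qed
  {
    case 0
    have "F 1 = K" using ch by (simp add: facial_reduction_chain_def)
    then show ?case using step[of 1 \<epsilon>] 0 x by simp
  next
    case (Suc n)
    let ?g = "diamonds \<psi>' (Suc n) \<epsilon> (norm x)"
    have IH: "infdist x (F (Suc (Suc n))) \<le> ?g" using Suc by simp
    \<comment> \<open>Nonnegativity comes from the distance that \<open>?g\<close> bounds, and makes
      \<open>\<epsilon> + ?g\<close> admissible in \<open>step\<close>.\<close>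
    then have "0 \<le> ?g" using infdist_nonneg order_trans by blast
    then show ?case
      using step[of "Suc (Suc n)" "\<epsilon> + ?g"] IH e0 Suc.prems by (simp add: diamond_def)
  }
qed

text \<open>The constant comes from the error bound for \<open>G\<close> and \<open>L + a\<close>,
  so it is fixed before the chain and the residual functions; only the rescalings depend on the
  chain.\<close>

theorem theorem23:
  fixes K L G :: "'a::euclidean_space set" and a :: 'a
  assumes "subspace L"
    and "closed K" and "convex_cone K" and "pointed K" and "amenable K"
    and "pps_condition G L a"
  shows "\<exists>\<kappa>>0. \<forall>(l::nat) F z \<psi>.
    facial_reduction_chain K L a l F z \<and> F l = G \<and>
    (\<forall>i\<in>{1..<l}. facial_residual_function K (F i) (z i) (\<psi> i)) \<longrightarrow>
    (\<exists>\<psi>'. (\<forall>i\<in>{1..<l}. positive_rescaling (\<psi> i) (\<psi>' i)) \<and>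
       (\<forall>x\<in>span K. \<forall>\<epsilon>.
          infdist x K \<le> \<epsilon> \<and> infdist x ((\<lambda>y. y + a) ` L) \<le> \<epsilon> \<longrightarrow>
          infdist x ((\<lambda>y. y + a) ` L \<inter> K)
            \<le> (\<kappa> * norm x + \<kappa>) * (\<epsilon> + chain_residual \<psi>' l \<epsilon> (norm x))))"
proof -
  let ?M = "(\<lambda>y. y + a) ` L"
  obtain \<kappa> where k: "\<kappa> > 0" and ne: "?M \<inter> G \<noteq> {}"
    and bound: "\<And>x \<epsilon>. infdist x G \<le> \<epsilon> \<Longrightarrow> infdist x ?M \<le> \<epsilon> \<Longrightarrow>
      infdist x (?M \<inter> G) \<le> (\<kappa> * norm x + \<kappa>) * \<epsilon>"
    using pps_error_bound[OF assms(1,6)] by blast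
  show ?thesis
  proof (intro exI[of _ \<kappa>] conjI k allI impI, elim conjE)
    fix l F z \<psi>
    assume ch: "facial_reduction_chain K L a l F z" and G: "F l = G"
      and frf: "\<forall>i\<in>{1..<l}. facial_residual_function K (F i) (z i) (\<psi> i)"
    define \<psi>' where "\<psi>' i = (\<lambda>s. \<psi> i (max 1 (norm (z i)) * s))" for i
    have resc: "positive_rescaling (\<psi> i) (\<psi>' i)" for i
      unfolding positive_rescaling_def
      by (intro exI[of _ "max 1 (norm (z i))"] exI[of _ 1] conjI) (auto simp: \<psi>'_def)
    have GK: "G \<subseteq> K" and l1: "l \<ge> 1" and F1: "F 1 = K"
    proof -
      have *: "l \<ge> 1" "F 1 = K" "\<forall>i\<in>{1..l}. cone_face (F i) K"
        using ch unfolding facial_reduction_chain_def by blast+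
      then have "cone_face (F l) K" by simp
      then show "G \<subseteq> K" "l \<ge> 1" "F 1 = K" using * G unfolding cone_face_def by blast+
    qed
    have "infdist x (?M \<inter> K) \<le> (\<kappa> * norm x + \<kappa>) * (\<epsilon> + chain_residual \<psi>' l \<epsilon> (norm x))"
      if x: "x \<in> span K" "infdist x K \<le> \<epsilon>" "infdist x ?M \<le> \<epsilon>" for x \<epsilon>
    proof -
      have e0: "\<epsilon> \<ge> 0" using x(2) infdist_nonneg[of x K] by linarith
      have "infdist x G \<le> chain_residual \<psi>' l \<epsilon> (norm x)"
      proof (cases "l \<ge> 2")
        case True
        then obtain n where n: "l = Suc (Suc n)" by (metis add_2_eq_Suc le_Suc_ex)
        then show ?thesis
          using infdist_chain_le_diamonds[OF assms(1) ch _ \<psi>'_def x, of n] frf G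
          by (simp add: chain_residual_def)
      next
        case False
        then have "G = K" using l1 F1 G by (metis One_nat_def Suc_1 le_antisym not_less_eq_eq)
        then show ?thesis using False x by (simp add: chain_residual_def)
      qed
      moreover from this have "chain_residual \<psi>' l \<epsilon> (norm x) \<ge> 0"
        using infdist_nonneg order_trans by blast
      \<comment> \<open>The sum of the two nonnegative bounds dominates both the distance to
        \<open>G\<close> and the distance to \<open>?M\<close>.\<close>
      ultimately have "infdist x (?M \<inter> G) \<le> (\<kappa> * norm x + \<kappa>) * (\<epsilon> + chain_residual \<psi>' l \<epsilon> (norm x))"
        using x e0 by (intro bound) auto
      moreover have "infdist x (?M \<inter> K) \<le> infdist x (?M \<inter> G)"
        using GK ne by (intro infdist_mono) auto
      ultimately show ?thesis by simp
    qed
    then show "\<exists>\<psi>'. (\<forall>i\<in>{1..<l}. positive_rescaling (\<psi> i) (\<psi>' i)) \<and>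
       (\<forall>x\<in>span K. \<forall>\<epsilon>. infdist x K \<le> \<epsilon> \<and> infdist x ?M \<le> \<epsilon> \<longrightarrow>
          infdist x (?M \<inter> K) \<le> (\<kappa> * norm x + \<kappa>) * (\<epsilon> + chain_residual \<psi>' l \<epsilon> (norm x)))"
      using resc by blast
  qed
qed

end
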